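(* Let $a_j,b_j\in\mathbb{N}_0$ and $c_j\in\mathbb{Z}$ with $c_j\ge3$ for all $j\ge0$ (resp. $j\ge1$). Then for every $n\in\mathbb{N}$: (i) If $r\ge1$ and $\mathbf{s}=(\{2\}^{b_1},c_1,\{2\}^{a_1},1,\dots,\{2\}^{b_r},c_r,\{2\}^{a_r},1)$, then \[H^\star_n(\mathbf{s})=\sum_{\mathbf{p}\in\Pi(\overline{2b_1+2},\{1\}^{c_1-3},\overline{2a_1+2},\,\dots,\,\overline{2b_r+2},\{1\}^{c_r-3},\overline{2a_r+2})}2^{\ell(\mathbf{p})}\mathcal{H}_n(\mathbf{p}).\] (ii) If $r\ge0$ and $\mathbf{s}=(\{2\}^{a_0},1,\{2\}^{b_1},c_1,\{2\}^{a_1},1,\dots,\{2\}^{b_r},c_r,\{2\}^{a_r},1)$, then \[H^\star_n(\mathbf{s})=\sum_{\mathbf{p}\in\Pi(2a_0+1,\overline{2b_1+2},\{1\}^{c_1-3},\overline{2a_1+2},\,\dots,\,\overline{2b_r+2},\{1\}^{c_r-3},\overline{2a_r+2})}2^{\ell(\mathbf{p})}\mathcal{H}_n(\mathbf{p}).\]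
   Context: $\mathbb{N}=\{1,2,\dots\}$, $\mathbb{N}_0=\mathbb{N}\cup\{0\}$; for a positive integer $m$, $\overline{m}$ denotes $-m$. $\{x\}^a$ denotes $a$ consecutive copies of $x$ (empty if $a=0$). For $\mathbf{s}=(s_1,\dots,s_\ell)$ with nonzero integer entries, $H_n(\mathbf{s})=\sum_{n\ge k_1>\cdots>k_\ell\ge1}\prod_{i=1}^\ell \frac{\operatorname{sgn}(s_i)^{k_i}}{k_i^{|s_i|}}$ and $H^\star_n(\mathbf{s})=\sum_{n\ge k_1\ge\cdots\ge k_\ell\ge1}\prod_{i=1}^\ell \frac{\operatorname{sgn}(s_i)^{k_i}}{k_i^{|s_i|}}$, with $H_n(\mathbf{s})=0$ if $n<\ell$ and $H_n(\emptyset)=H^\star_n(\emptyset)=1$. For nonzero integers $a,b$, $a\oplus b=\operatorname{sgn}(a)b+\operatorname{sgn}(b)a$. For a sequence $(s_1,\dots,s_m)$ of nonzero integers, $\Pi(s_1,\dots,s_m)$ is the set of the $2^{m-1}$ indices $s_1\circ\cdots\circ s_m$ where each $\circ$ is independently either "," or $\oplus$ (entries joined by $\oplus$ merge into one component); $\ell(\mathbf{p})$ is the number of components. For $\mathbf{p}=(p_1,\dots,p_m)$, $\mathcal{H}_n(\mathbf{p})=\sum_{k=1}^n\frac{\operatorname{sgn}(p_1)^k}{k^{|p_1|}}\frac{\binom{n}{k}}{\binom{n+k}{k}}H_{k-1}(p_2,\dots,p_m)$. *)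

theory Defs
  imports Complex_Main
begin

text \<open>Indices are lists of nonzero integers; a negative entry stands for a barred
  (alternating) argument. The summation variables $k_1, \dots, k_\ell$ are the entries of a list
  of the same length.\<close>

definition summand :: "int list \<Rightarrow> nat list \<Rightarrow> real" where
  "summand s ks =
     (\<Prod>i<length s. of_int (sgn (s ! i)) ^ (ks ! i) / real (ks ! i) ^ nat \<bar>s ! i\<bar>)"

definition mhs :: "nat \<Rightarrow> int list \<Rightarrow> real" where
  "mhs n s =
     (\<Sum>ks | length ks = length s \<and> set ks \<subseteq> {1..n} \<and> sorted_wrt (>) ks. summand s ks)"

definition mhs_star :: "nat \<Rightarrow> int list \<Rightarrow> real" where
  "mhs_star n s =
     (\<Sum>ks | length ks = length s \<and> set ks \<subseteq> {1..n} \<and> sorted_wrt (\<ge>) ks. summand s ks)"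

definition oplus :: "int \<Rightarrow> int \<Rightarrow> int" where
  "oplus x y = sgn x * y + sgn y * x"

text \<open>The recursion decides the leftmost connective: a comma, or a merge of the first two
  entries (the merge is associative on nonzero integers). The partial sums of absolute
  values at the commas recover the choices, so for nonzero entries the $2^{m-1}$ choices give
  distinct indices and nothing is lost by collecting them in a set. The value at the
  empty sequence is a convention.\<close>

fun merges :: "int list \<Rightarrow> int list set" where
  "merges [] = {[]}"
| "merges [x] = {[x]}"
| "merges (x # y # zs) = (#) x ` merges (y # zs) \<union> merges (oplus x y # zs)"

text \<open>Only nonempty indices occur; the value at the empty one is a convention.\<close>

fun binom_mhs :: "nat \<Rightarrow> int list \<Rightarrow> real" where
  "binom_mhs n [] = 0"
| "binom_mhs n (p # ps) =
     (\<Sum>k = 1..n. of_int (sgn p) ^ k / real k ^ nat \<bar>p\<bar>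
        * (real (n choose k) / real ((n + k) choose k)) * mhs (k - 1) ps)"

definition star_blocks :: "(nat \<Rightarrow> nat) \<Rightarrow> (nat \<Rightarrow> nat) \<Rightarrow> (nat \<Rightarrow> int) \<Rightarrow> nat \<Rightarrow> int list" where
  "star_blocks a b c r =
     concat (map (\<lambda>j. replicate (b j) 2 @ [c j] @ replicate (a j) 2 @ [1]) [1..<r + 1])"

definition merge_blocks :: "(nat \<Rightarrow> nat) \<Rightarrow> (nat \<Rightarrow> nat) \<Rightarrow> (nat \<Rightarrow> int) \<Rightarrow> nat \<Rightarrow> int list" where
  "merge_blocks a b c r =
     concat (map (\<lambda>j. [- (2 * int (b j) + 2)] @ replicate (nat (c j - 3)) 1 @ [- (2 * int (a j) + 2)])
       [1..<r + 1])"

end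

theory Submission
  imports Defs
begin

text \<open>Put $w(n,k) = \binom nk / \binom{n+k}k$ and $T_n f = \sum_{k=1}^n w(n,k) f(k)$.
  Since $w(n,k) - w(n-1,k) = (k^2/n^2)\, w(n,k)$, prefixing an entry 2 to the star index
  corresponds to dividing $f(k)$ by $k^2$. Since $2k\,w(n,k)$ telescopes in $k$,
  $n\,T_n f = T_n(k\,P f)$ where $P f(k) = f(k) + 2\sum_{j<k} f(j)$, so prefixing 1 corresponds to
  $f \mapsto (P f)/k$. As $P$ is inverted by conjugation with the sign $(-1)^k$, prefixing
  $c \ge 3$ corresponds to iterating $(-1)^k P\, (-1)^k / k$, whose inner signs cancel: this produces
  the two barred entries with $c - 3$ ones between them. On the other side, summing
  $2^{\ell(\mathbf p)}$ over all merges amounts to joining consecutive entries by $P$.\<close>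

section \<open>Weights, doubled sums and the binomial transform\<close>

definition weight :: "int \<Rightarrow> nat \<Rightarrow> real" where
  "weight x k = of_int (sgn x) ^ k / real k ^ nat \<bar>x\<bar>"

text \<open>This encodes one connective followed by the factor 2 per component: the diagonal term
  comes from a merge, the doubled strict sum from a comma.\<close>

definition double_sum :: "(nat \<Rightarrow> real) \<Rightarrow> nat \<Rightarrow> real" where
  "double_sum f k = f k + 2 * (\<Sum>j = 1..<k. f j)"

definition binom_ratio :: "nat \<Rightarrow> nat \<Rightarrow> real" where
  "binom_ratio n k = real (n choose k) / real ((n + k) choose k)"

definition binom_transform :: "nat \<Rightarrow> (nat \<Rightarrow> real) \<Rightarrow> real" where
  "binom_transform n f = (\<Sum>k = 1..n. binom_ratio n k * f k)"

text \<open>Closed form of the sum over all merges, as \<open>sum_merges_leading_term\<close> shows;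
  \<open>k\<close> is the largest summation variable. The 2 in the singleton case belongs to the
  last component; the value at the empty list is a convention.\<close>

fun merged_term :: "int list \<Rightarrow> nat \<Rightarrow> real" where
  "merged_term [] k = 0"
| "merged_term [x] k = 2 * weight x k"
| "merged_term (x # y # zs) k = weight x k * double_sum (merged_term (y # zs)) k"

section \<open>Recursions splitting off the largest summation variable\<close>

lemma summand_Cons: "summand (x # s) (k # ks) = weight x k * summand s ks"
  by (simp add: summand_def weight_def prod.lessThan_Suc_shift del: prod.lessThan_Suc)

lemma finite_indices: "finite {ks. length ks = l \<and> set ks \<subseteq> {1..n::nat} \<and> Q ks}"
  by (rule finite_subset[OF _ finite_lists_length_eq[of "{1..n}" l]]) auto

lemma mhs_Cons: "mhs n (x # s) = (\<Sum>k = 1..n. weight x k * mhs (k - 1) s)"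
proof -
  let ?A = "\<lambda>m. {ks. length ks = length s \<and> set ks \<subseteq> {1..m} \<and> sorted_wrt (>) ks}"
  have "mhs n (x # s) = (\<Sum>(k, ks)\<in>(SIGMA k:{1..n}. ?A (k - 1)). weight x k * summand s ks)"
    unfolding mhs_def
  proof (rule sum.reindex_bij_witness[of _ "\<lambda>(k, ks). k # ks" "\<lambda>ks. (hd ks, tl ks)"])
    fix ks assume "ks \<in> {ks. length ks = length (x # s) \<and> set ks \<subseteq> {1..n} \<and> sorted_wrt (>) ks}"
    then show "(hd ks, tl ks) \<in> (SIGMA k:{1..n}. ?A (k - 1))"
      by (cases ks) fastforce+
  next
    fix q assume "q \<in> (SIGMA k:{1..n}. ?A (k - 1))"
    then show "(case q of (k, ks) \<Rightarrow> k # ks)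
        \<in> {ks. length ks = length (x # s) \<and> set ks \<subseteq> {1..n} \<and> sorted_wrt (>) ks}"
      by (cases q) fastforce
  qed (auto simp: length_Suc_conv summand_Cons)
  also have "\<dots> = (\<Sum>k = 1..n. weight x k * mhs (k - 1) s)"
    by (subst sum.Sigma[symmetric]) (auto simp: mhs_def sum_distrib_left finite_indices[simplified])
  finally show ?thesis .
qed

lemma mhs_star_Cons: "mhs_star n (x # s) = (\<Sum>k = 1..n. weight x k * mhs_star k s)"
proof -
  let ?A = "\<lambda>m. {ks. length ks = length s \<and> set ks \<subseteq> {1..m} \<and> sorted_wrt (\<ge>) ks}"
  have "mhs_star n (x # s) = (\<Sum>(k, ks)\<in>(SIGMA k:{1..n}. ?A k). weight x k * summand s ks)"
    unfolding mhs_star_def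
  proof (rule sum.reindex_bij_witness[of _ "\<lambda>(k, ks). k # ks" "\<lambda>ks. (hd ks, tl ks)"])
    fix ks assume "ks \<in> {ks. length ks = length (x # s) \<and> set ks \<subseteq> {1..n} \<and> sorted_wrt (\<ge>) ks}"
    then show "(hd ks, tl ks) \<in> (SIGMA k:{1..n}. ?A k)"
      by (cases ks) fastforce+
  next
    fix q assume "q \<in> (SIGMA k:{1..n}. ?A k)"
    then show "(case q of (k, ks) \<Rightarrow> k # ks)
        \<in> {ks. length ks = length (x # s) \<and> set ks \<subseteq> {1..n} \<and> sorted_wrt (\<ge>) ks}"
      by (cases q) fastforce
  qed (auto simp: length_Suc_conv summand_Cons)
  also have "\<dots> = (\<Sum>k = 1..n. weight x k * mhs_star k s)"
    by (subst sum.Sigma[symmetric]) (auto simp: mhs_star_def sum_distrib_left finite_indices[simplified])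
  finally show ?thesis .
qed

lemma mhs_Nil: "mhs n [] = 1"
proof -
  have "{ks. length ks = length ([] :: int list) \<and> set ks \<subseteq> {1..n} \<and> sorted_wrt (>) ks} = {[]}"
    by auto
  then show ?thesis by (simp add: mhs_def summand_def)
qed

lemma mhs_star_Nil: "mhs_star n [] = 1"
proof -
  have "{ks. length ks = length ([] :: int list) \<and> set ks \<subseteq> {1..n} \<and> sorted_wrt (\<ge>) ks} = {[]}"
    by auto
  then show ?thesis by (simp add: mhs_star_def summand_def)
qed

section \<open>Summation over all merges of a sequence\<close>

lemma oplus_nonzero: "x \<noteq> 0 \<Longrightarrow> y \<noteq> 0 \<Longrightarrow> oplus x y \<noteq> 0"
  by (auto simp: oplus_def sgn_if)

lemma abs_oplus: "x \<noteq> 0 \<Longrightarrow> y \<noteq> 0 \<Longrightarrow> \<bar>oplus x y\<bar> = \<bar>x\<bar> + \<bar>y\<bar>"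
  by (auto simp: oplus_def sgn_if)

lemma sgn_oplus: "x \<noteq> 0 \<Longrightarrow> y \<noteq> 0 \<Longrightarrow> sgn (oplus x y) = sgn x * sgn y"
  by (auto simp: oplus_def sgn_if)

text \<open>Signs multiply and absolute values add under \<open>oplus\<close>, so a merge amounts to
  giving two entries the same summation variable.\<close>

lemma weight_oplus:
  assumes "x \<noteq> 0" "y \<noteq> 0"
  shows "weight (oplus x y) k = weight x k * weight y k"
  using assms
  by (simp add: weight_def sgn_oplus abs_oplus power_mult_distrib nat_add_distrib power_add)

lemma finite_merges: "finite (merges t)"
  by (induction t rule: merges.induct) auto

lemma Nil_notin_merges: "t \<noteq> [] \<Longrightarrow> [] \<notin> merges t"
  by (induction t rule: merges.induct) auto

text \<open>Merging nonzero entries only increases absolute values. This later separates the indices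
  that start with a comma from those that start with a merge.\<close>

lemma hd_merges_ge:
  "\<lbrakk>p \<in> merges t; t \<noteq> []; 0 \<notin> set t\<rbrakk> \<Longrightarrow> \<bar>hd p\<bar> \<ge> \<bar>hd t\<bar>"
proof (induction t arbitrary: p rule: merges.induct)
  case (3 x y zs)
  show ?case
  proof (cases "p \<in> merges (oplus x y # zs)")
    case True
    with 3 have "\<bar>hd p\<bar> \<ge> \<bar>oplus x y\<bar>"
      by (auto simp: oplus_nonzero)
    then show ?thesis using 3 by (auto simp: abs_oplus)
  next
    case False
    with 3 show ?thesis by auto
  qed
qed auto

text \<open>The part of \<open>mhs\<close> whose largest variable equals \<open>k\<close>; weighted
  by \<open>binom_ratio\<close> and summed over \<open>k\<close> it gives
  \<open>binom_mhs\<close>.\<close>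

definition leading_term :: "int list \<Rightarrow> nat \<Rightarrow> real" where
  "leading_term p k = weight (hd p) k * mhs (k - 1) (tl p)"

lemma mhs_eq_sum_leading_term: "p \<noteq> [] \<Longrightarrow> mhs n p = (\<Sum>k = 1..n. leading_term p k)"
  by (cases p) (auto simp: mhs_Cons leading_term_def)

lemma merged_term_oplus:
  assumes "x \<noteq> 0" "y \<noteq> 0"
  shows "merged_term (oplus x y # zs) k = weight x k * merged_term (y # zs) k"
  using assms by (cases zs) (auto simp: weight_oplus)

text \<open>Split by the first connective. A comma adds one component, hence a factor 2, and lets
  the next variable run strictly below \<open>k\<close>; a merge keeps it equal to \<open>k\<close>.
  Together they form \<open>double_sum\<close>.\<close>

lemma sum_merges_leading_term:
  assumes "t \<noteq> []" "0 \<notin> set t"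
  shows "(\<Sum>p\<in>merges t. 2 ^ length p * leading_term p k) = merged_term t k"
  using assms
proof (induction t arbitrary: k rule: merges.induct)
  case (3 x y zs)
  let ?M = "merges (y # zs)" and ?N = "merges (oplus x y # zs)"
  have nz: "x \<noteq> 0" "y \<noteq> 0" "0 \<notin> set (y # zs)" "0 \<notin> set (oplus x y # zs)"
    using 3(4) by (auto simp: oplus_nonzero)
  \<comment> \<open>After a comma the head is \<open>x\<close>; after a merge its absolute value is
    at least \<bar>x\<bar> + \<bar>y\<bar>, which is larger.\<close>
  have disj: "(#) x ` ?M \<inter> ?N = {}"
  proof -
    have "\<bar>hd p\<bar> > \<bar>x\<bar>" if "p \<in> ?N" for p
      using hd_merges_ge[OF that] nz abs_oplus[of x y] by auto
    then show ?thesis by fastforce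
  qed
  have "(\<Sum>p\<in>?M. 2 ^ length (x # p) * leading_term (x # p) k)
      = (\<Sum>p\<in>?M. 2 * weight x k * (\<Sum>j = 1..k - 1. 2 ^ length p * leading_term p j))"
  proof (rule sum.cong[OF refl])
    fix p assume "p \<in> ?M"
    then have "p \<noteq> []" using Nil_notin_merges by blast
    then have "leading_term (x # p) k = weight x k * (\<Sum>j = 1..k - 1. leading_term p j)"
      by (simp add: leading_term_def[of "x # p"] mhs_eq_sum_leading_term)
    then show "2 ^ length (x # p) * leading_term (x # p) k
        = 2 * weight x k * (\<Sum>j = 1..k - 1. 2 ^ length p * leading_term p j)"
      by (simp add: sum_distrib_left[symmetric])
  qed
  also have "\<dots> = 2 * weight x k * (\<Sum>j = 1..k - 1. \<Sum>p\<in>?M. 2 ^ length p * leading_term p j)"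
    by (subst sum.swap) (simp only: sum_distrib_left)
  also have "\<dots> = 2 * weight x k * (\<Sum>j = 1..k - 1. merged_term (y # zs) j)"
    using 3(1) nz by simp
  also have "{1..k - 1} = {1..<k}" by auto
  finally have "(\<Sum>p\<in>?M. 2 ^ length (x # p) * leading_term (x # p) k)
      = 2 * weight x k * (\<Sum>j = 1..<k. merged_term (y # zs) j)" .
  moreover have "(\<Sum>p\<in>?N. 2 ^ length p * leading_term p k) = weight x k * merged_term (y # zs) k"
    using 3(2)[of k] nz by (simp add: merged_term_oplus)
  moreover have "(\<Sum>p\<in>merges (x # y # zs). 2 ^ length p * leading_term p k)
      = (\<Sum>p\<in>?M. 2 ^ length (x # p) * leading_term (x # p) k)
        + (\<Sum>p\<in>?N. 2 ^ length p * leading_term p k)"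
    using disj by (simp add: sum.union_disjoint finite_merges sum.reindex)
  ultimately show ?case
    by (simp add: double_sum_def algebra_simps)
qed (auto simp: leading_term_def mhs_Nil)

lemma binom_mhs_eq_transform:
  "p \<noteq> [] \<Longrightarrow> binom_mhs n p = binom_transform n (leading_term p)"
  by (cases p)
    (auto simp: binom_transform_def leading_term_def binom_ratio_def weight_def mult_ac intro!: sum.cong)

lemma sum_merges_binom_mhs:
  assumes "t \<noteq> []" "0 \<notin> set t"
  shows "(\<Sum>p\<in>merges t. 2 ^ length p * binom_mhs n p) = binom_transform n (merged_term t)"
proof -
  have "(\<Sum>p\<in>merges t. 2 ^ length p * binom_mhs n p)
      = (\<Sum>p\<in>merges t. \<Sum>k = 1..n. binom_ratio n k * (2 ^ length p * leading_term p k))"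
  proof (rule sum.cong[OF refl])
    fix p assume "p \<in> merges t"
    then have "p \<noteq> []" using Nil_notin_merges assms(1) by blast
    then show "2 ^ length p * binom_mhs n p
        = (\<Sum>k = 1..n. binom_ratio n k * (2 ^ length p * leading_term p k))"
      by (simp add: binom_mhs_eq_transform binom_transform_def sum_distrib_left mult_ac)
  qed
  also have "\<dots> = (\<Sum>k = 1..n. binom_ratio n k * (\<Sum>p\<in>merges t. 2 ^ length p * leading_term p k))"
    by (subst sum.swap) (simp add: sum_distrib_left)
  also have "\<dots> = binom_transform n (merged_term t)"
    using assms by (simp add: sum_merges_leading_term binom_transform_def)
  finally show ?thesis .
qed

section \<open>Recurrences and tail sums of the binomial ratio\<close>

lemma binom_ratio_fact:
  "k \<le> n \<Longrightarrow> binom_ratio n k = fact n * fact n / (fact (n - k) * fact (n + k))"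
  by (simp add: binom_ratio_def binomial_fact field_simps)

lemma binom_ratio_Suc:
  assumes "k \<le> n"
  shows "real (n + k + 1) * binom_ratio n (Suc k) = (real n - real k) * binom_ratio n k"
proof (cases "k = n")
  case True
  then show ?thesis by (simp add: binom_ratio_def)
next
  case False
  then obtain m where m: "n = k + Suc m"
    using assms by (metis add_Suc_right le_neq_implies_less less_imp_Suc_add)
  have "real (n + k + 1) * binom_ratio n (Suc k)
      = real (n + k + 1) * (fact n * fact n / (fact m * fact (Suc (n + k))))"
    using m by (subst binom_ratio_fact) auto
  also have "\<dots> = fact n * fact n / (fact m * fact (n + k))"
    by (simp add: field_simps del: of_nat_Suc)
  also have "\<dots> = real (Suc m) * (fact n * fact n / (fact (Suc m) * fact (n + k)))"
    by (simp add: field_simps del: of_nat_Suc)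
  also have "\<dots> = (real n - real k) * binom_ratio n k"
    using m by (subst binom_ratio_fact) auto
  finally show ?thesis .
qed

text \<open>By factorials, passing from n to n+1 multiplies the ratio by (n+1)^2 / ((n+1-k)(n+1+k)),
  and (n+1)^2 - (n+1-k)(n+1+k) = k^2.\<close>

lemma binom_ratio_pred:
  assumes "k \<le> Suc n"
  shows "binom_ratio (Suc n) k - binom_ratio n k
    = real k ^ 2 / real (Suc n) ^ 2 * binom_ratio (Suc n) k"
proof (cases "k = Suc n")
  case True
  then show ?thesis by (simp add: binom_ratio_def)
next
  case False
  then obtain m where m: "n = k + m"
    using assms by (metis le_Suc_eq le_iff_add)
  have r: "binom_ratio (Suc n) k = real (Suc n) ^ 2 / (real (Suc m) * real (Suc (n + k)))
      * binom_ratio n k"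
    using m by (simp add: binom_ratio_fact power2_eq_square field_simps del: of_nat_Suc)
  have k: "real k ^ 2 = real (Suc n) ^ 2 - real (Suc m) * real (Suc (n + k))"
    using m by (simp add: power2_eq_square algebra_simps)
  show ?thesis
    unfolding r k by (simp add: diff_divide_distrib left_diff_distrib del: of_nat_Suc)
qed

text \<open>Downward induction from j = n, where both sides vanish. In the step 2(j+1) + (n-j-1) =
  n+j+1, and \<open>binom_ratio_Suc\<close> turns this into the closed form at j.\<close>

lemma sum_binom_ratio_tail:
  assumes "j \<le> n"
  shows "(\<Sum>k = Suc j..n. 2 * real k * binom_ratio n k) = (real n - real j) * binom_ratio n j"
  using assms
proof (induction rule: inc_induct)
  case (step j)
  have "(\<Sum>k = Suc j..n. 2 * real k * binom_ratio n k)
      = 2 * real (Suc j) * binom_ratio n (Suc j) + (\<Sum>k = Suc (Suc j)..n. 2 * real k * binom_ratio n k)"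
    using step(2) by (subst sum.atLeast_Suc_atMost) auto
  also have "\<dots> = real (n + j + 1) * binom_ratio n (Suc j)"
    using step by (simp add: algebra_simps)
  also have "\<dots> = (real n - real j) * binom_ratio n j"
    using step by (intro binom_ratio_Suc) auto
  finally show ?case .
qed auto

section \<open>Prefixing entries to a star index\<close>

lemma binom_transform_cong:
  "(\<And>k. k \<ge> 1 \<Longrightarrow> f k = g k) \<Longrightarrow> binom_transform n f = binom_transform n g"
  by (auto simp: binom_transform_def)

text \<open>After interchanging the sums, the tail sum gives f(j) the coefficient (n-j) w(n,j); the
  diagonal term supplies the missing j w(n,j).\<close>

lemma mult_binom_transform:
  "real n * binom_transform n f = binom_transform n (\<lambda>k. real k * double_sum f k)"
proof -
  have "(\<Sum>k = 1..n. 2 * real k * binom_ratio n k * (\<Sum>j = 1..<k. f j))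
      = (\<Sum>k = 1..n. \<Sum>j = 1..<k. 2 * real k * binom_ratio n k * f j)"
    by (simp add: sum_distrib_left)
  also have "\<dots> = (\<Sum>j = 1..n. \<Sum>k = Suc j..n. 2 * real k * binom_ratio n k * f j)"
    by (simp add: sum.Sigma)
      (rule sum.reindex_bij_witness[of _ "\<lambda>(a, b). (b, a)" "\<lambda>(a, b). (b, a)"]; auto)
  also have "\<dots> = (\<Sum>j = 1..n. (real n - real j) * binom_ratio n j * f j)"
    by (simp add: sum_distrib_right[symmetric] sum_binom_ratio_tail)
  finally have "binom_transform n (\<lambda>k. real k * double_sum f k)
      = (\<Sum>k = 1..n. real k * binom_ratio n k * f k)
        + (\<Sum>j = 1..n. (real n - real j) * binom_ratio n j * f j)"
    by (simp add: binom_transform_def double_sum_def algebra_simps sum.distrib)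
  also have "\<dots> = real n * binom_transform n f"
    by (simp add: binom_transform_def sum.distrib[symmetric] sum_distrib_left algebra_simps)
  finally show ?thesis by simp
qed

text \<open>Both sides vanish at n = 0, so it suffices to compare increments in n. By
  \<open>binom_ratio_pred\<close> the increment of the transform carries the factor k^2/n^2, as in
  the assumption.\<close>

lemma mhs_star_Cons_transform:
  assumes "\<And>n. n \<ge> 1 \<Longrightarrow>
    weight x n * mhs_star n s = binom_transform n (\<lambda>k. real k ^ 2 * f k) / real n ^ 2"
  shows "mhs_star n (x # s) = binom_transform n f"
proof (induction n)
  case 0
  show ?case by (simp add: mhs_star_Cons binom_transform_def)
next
  case (Suc n)
  \<comment> \<open>The extra term k = n+1 is zero because the binomial coefficient vanishes there;
    both transforms now have the same range.\<close>
  have "binom_transform n f = (\<Sum>k = 1..Suc n. binom_ratio n k * f k)"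
    by (simp add: binom_transform_def binom_ratio_def)
  then have "binom_transform (Suc n) f - binom_transform n f
      = (\<Sum>k = 1..Suc n. (binom_ratio (Suc n) k - binom_ratio n k) * f k)"
    by (simp only: binom_transform_def[of "Suc n"] sum_subtractf[symmetric] left_diff_distrib)
  also have "\<dots> = (\<Sum>k = 1..Suc n. binom_ratio (Suc n) k * (real k ^ 2 * f k) / real (Suc n) ^ 2)"
    by (rule sum.cong) (auto simp: binom_ratio_pred simp del: of_nat_Suc)
  also have "\<dots> = weight x (Suc n) * mhs_star (Suc n) s"
    by (simp only: assms[of "Suc n"] binom_transform_def sum_divide_distrib)
  finally show ?case
    using Suc by (simp add: mhs_star_Cons)
qed

lemma mhs_star_twos_transform:
  assumes "\<And>n. mhs_star n s = binom_transform n f"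
  shows "mhs_star n (replicate b 2 @ s) = binom_transform n (\<lambda>k. f k / real k ^ (2 * b))"
proof (induction b arbitrary: n)
  case 0
  show ?case by (simp add: assms)
next
  case (Suc b)
  have "mhs_star n (2 # replicate b 2 @ s) = binom_transform n (\<lambda>k. f k / real k ^ (2 * Suc b))"
  proof (rule mhs_star_Cons_transform)
    fix n :: nat assume "n \<ge> 1"
    show "weight 2 n * mhs_star n (replicate b 2 @ s)
      = binom_transform n (\<lambda>k. real k ^ 2 * (f k / real k ^ (2 * Suc b))) / real n ^ 2"
      unfolding Suc weight_def
      by (simp, intro disjI2 binom_transform_cong) (auto simp: field_simps power2_eq_square)
  qed
  then show ?case by simp
qed

lemma mhs_star_one_transform:
  assumes "\<And>n. mhs_star n s = binom_transform n f"
  shows "mhs_star n (1 # s) = binom_transform n (\<lambda>k. double_sum f k / real k)"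
proof (rule mhs_star_Cons_transform)
  fix n :: nat assume n: "n \<ge> 1"
  have "real n * mhs_star n s
      = binom_transform n (\<lambda>k. real k ^ 2 * (double_sum f k / real k))"
    unfolding assms mult_binom_transform
    by (rule binom_transform_cong) (auto simp: power2_eq_square)
  then show "weight 1 n * mhs_star n s
      = binom_transform n (\<lambda>k. real k ^ 2 * (double_sum f k / real k)) / real n ^ 2"
    using n by (simp add: weight_def field_simps power2_eq_square)
qed

text \<open>The recursion starts here and not at the empty index, whose value 1 at n = 0 is not that
  of a transform. The tail sum from j = 0 gives n.\<close>

lemma mhs_star_singleton_one: "mhs_star n [1] = binom_transform n (\<lambda>k. 2 / real k)"
proof (rule mhs_star_Cons_transform)
  fix n :: nat assume n: "n \<ge> 1"
  have "binom_transform n (\<lambda>k. real k ^ 2 * (2 / real k)) = real n"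
    using sum_binom_ratio_tail[of 0 n]
    by (simp add: binom_transform_def binom_ratio_def power2_eq_square mult_ac)
  then show "weight 1 n * mhs_star n []
      = binom_transform n (\<lambda>k. real k ^ 2 * (2 / real k)) / real n ^ 2"
    using n by (simp add: weight_def mhs_star_Nil power2_eq_square)
qed

section \<open>Inverting the doubled sum; entries at least 3\<close>

lemma double_sum_Suc: "k \<ge> 1 \<Longrightarrow> double_sum f (Suc k) = double_sum f k + f k + f (Suc k)"
  by (simp add: double_sum_def)

text \<open>On generating functions \<open>double_sum\<close> is multiplication by (1+x)/(1-x).
  Conjugation by the sign replaces x by -x, which yields the reciprocal factor.\<close>

lemma double_sum_alternating_inverse:
  assumes "k \<ge> 1"
  shows "double_sum (\<lambda>j. (-1) ^ j * double_sum (\<lambda>i. (-1) ^ i * f i) j) k = f k"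
  using assms
proof (induction k rule: nat_induct_at_least)
  case base
  show ?case by (simp add: double_sum_def)
next
  case (Suc k)
  let ?g = "double_sum (\<lambda>i. (-1) ^ i * f i)"
  have "double_sum (\<lambda>j. (-1) ^ j * ?g j) (Suc k) = f k + (-1) ^ k * (?g k - ?g (Suc k))"
    unfolding double_sum_Suc[OF Suc.hyps, of "\<lambda>j. (-1) ^ j * ?g j"] Suc.IH
    by (simp add: right_diff_distrib)
  also have "\<dots> = f (Suc k)"
    using Suc by (simp add: double_sum_Suc algebra_simps flip: power_add mult_2)
  finally show ?case .
qed

lemma merged_term_Cons:
  "ts \<noteq> [] \<Longrightarrow> merged_term (x # ts) k = weight x k * double_sum (merged_term ts) k"
  by (cases ts) auto

text \<open>Each factor n applies \<open>double_sum\<close>, which cancels the sign-conjugated one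
  and exposes the next entry: m factors remove the ones, the last reaches \<open>ts\<close>.
  Multiplying by powers of n avoids dividing by n.\<close>

lemma power_mult_binom_transform_ones:
  assumes "\<And>k. k \<ge> 1 \<Longrightarrow> f k = real k * ((-1) ^ k * merged_term ts k)" and "ts \<noteq> []"
  shows "real n ^ Suc m *
      binom_transform n (\<lambda>k. (-1) ^ k * double_sum (merged_term (replicate m 1 @ ts)) k)
    = binom_transform n f"
proof (induction m)
  case (Suc m)
  let ?h = "merged_term (replicate m 1 @ ts)" and ?h' = "merged_term (replicate (Suc m) 1 @ ts)"
  have "real n * binom_transform n (\<lambda>k. (-1) ^ k * double_sum ?h' k)
      = binom_transform n (\<lambda>k. (-1) ^ k * double_sum ?h k)"
    unfolding mult_binom_transform
  proof (rule binom_transform_cong)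
    fix k :: nat assume k: "k \<ge> 1"
    \<comment> \<open>The inversion is applied to the signed sequence, so that the two inner signs
      cancel.\<close>
    have "double_sum (\<lambda>j. (-1) ^ j * double_sum ?h' j) k = (-1) ^ k * ?h' k"
      using double_sum_alternating_inverse[OF k, of "\<lambda>j. (-1) ^ j * ?h' j"]
      by (simp add: mult.assoc[symmetric] power_mult_distrib[symmetric])
    also have "?h' k = double_sum ?h k / real k"
      using assms(2) by (simp add: merged_term_Cons weight_def)
    finally show "real k * double_sum (\<lambda>j. (-1) ^ j * double_sum ?h' j) k
        = (-1) ^ k * double_sum ?h k"
      using k by simp
  qed
  then show ?case
    using Suc by (simp only: power_Suc2[of _ "Suc m"] mult.assoc)
next
  case 0
  have "real n * binom_transform n (\<lambda>k. (-1) ^ k * double_sum (merged_term ts) k)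
      = binom_transform n f"
    unfolding mult_binom_transform
  proof (rule binom_transform_cong)
    fix k :: nat assume k: "k \<ge> 1"
    show "real k * double_sum (\<lambda>j. (-1) ^ j * double_sum (merged_term ts) j) k = f k"
      using double_sum_alternating_inverse[OF k, of "\<lambda>j. (-1) ^ j * merged_term ts j"] assms(1)[OF k]
      by (simp add: mult.assoc[symmetric] power_mult_distrib[symmetric])
  qed
  then show ?case by simp
qed

text \<open>Write c = (c-3) + 1 + 2. The power n^(c-2) is absorbed by the ones and by the passage
  from \<open>f\<close> to \<open>ts\<close>; the remaining n^2 is the one in
  \<open>mhs_star_Cons_transform\<close>.\<close>

lemma mhs_star_ge3_transform:
  assumes "\<And>n. mhs_star n s = binom_transform n f"
    and "\<And>k. k \<ge> 1 \<Longrightarrow> f k = real k * ((-1) ^ k * merged_term ts k)" and "ts \<noteq> []"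
    and "c \<ge> 3"
  shows "mhs_star n (c # s)
    = binom_transform n (merged_term (- 2 # replicate (nat (c - 3)) 1 @ ts))"
proof (rule mhs_star_Cons_transform)
  fix n :: nat assume n: "n \<ge> 1"
  let ?m = "nat (c - 3)"
  let ?h = "merged_term (replicate ?m 1 @ ts)"
  have "binom_transform n (\<lambda>k. real k ^ 2 * merged_term (- 2 # replicate ?m 1 @ ts) k)
      = binom_transform n (\<lambda>k. (-1) ^ k * double_sum ?h k)"
    using assms(3) by (intro binom_transform_cong) (auto simp: merged_term_Cons weight_def)
  moreover have "nat \<bar>c\<bar> = Suc ?m + 2" using assms(4) by auto
  moreover have "mhs_star n s
      = real n ^ Suc ?m * binom_transform n (\<lambda>k. (-1) ^ k * double_sum ?h k)"
    using power_mult_binom_transform_ones[OF assms(2,3), of n ?m] assms(1) by simp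
  ultimately show "weight c n * mhs_star n s
      = binom_transform n (\<lambda>k. real k ^ 2 * merged_term (- 2 # replicate ?m 1 @ ts) k) / real n ^ 2"
    using n assms(4) by (simp add: weight_def power_add power2_eq_square)
qed

section \<open>Assembling the blocks\<close>

lemma merged_term_reweight:
  "weight x k = u * weight y k \<Longrightarrow> merged_term (x # ts) k = u * merged_term (y # ts) k"
  by (cases ts) auto

lemma weight_odd: "weight (2 * int m + 1) k = weight 1 k / real k ^ (2 * m)"
proof -
  have "nat \<bar>2 * int m + 1\<bar> = 2 * m + 1" by simp
  then show ?thesis by (simp add: weight_def)
qed

lemma weight_neg_even: "weight (- (2 * int m + 2)) k = (-1) ^ k / real k ^ (2 * m + 2)"
proof -
  have "nat \<bar>- (2 * int m + 2)\<bar> = 2 * m + 2" by simp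
  then show ?thesis by (simp add: weight_def sgn_if)
qed

text \<open>Induction over an arbitrary list of block numbers, since removing the first block from
  1, ..., r leaves a list that no longer starts at 1.\<close>

lemma mhs_star_blocks_transform:
  fixes a b :: "nat \<Rightarrow> nat" and c :: "nat \<Rightarrow> int"
  defines "S \<equiv> \<lambda>js. concat (map (\<lambda>j. replicate (b j) 2 @ [c j] @ replicate (a j) 2 @ [1]) js)"
    and "M \<equiv> \<lambda>js. concat (map (\<lambda>j. [- (2 * int (b j) + 2)] @ replicate (nat (c j - 3)) 1
        @ [- (2 * int (a j) + 2)]) js)"
  assumes "\<forall>j\<in>set js. c j \<ge> 3"
  shows "js \<noteq> [] \<Longrightarrow> mhs_star n (S js) = binom_transform n (merged_term (M js))"
    and "mhs_star n (replicate m 2 @ [1] @ S js)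
      = binom_transform n (merged_term ((2 * int m + 1) # M js))"
proof -
  \<comment> \<open>Needed twice: for the tail {2}^a, 1 of a block inside the induction, and for the
    second claim. The premise is conditional so that an empty \<open>js\<close> falls back on the
    index [1].\<close>
  have prefix_one: "mhs_star n (replicate m 2 @ [1] @ S js)
      = binom_transform n (merged_term ((2 * int m + 1) # M js))"
    if "js \<noteq> [] \<Longrightarrow> (\<And>n. mhs_star n (S js) = binom_transform n (merged_term (M js)))" for js n m
  proof -
    have "mhs_star n (1 # S js) = binom_transform n (merged_term (1 # M js))" for n
    proof (cases js)
      case Nil
      then show ?thesis
        by (simp add: S_def M_def mhs_star_singleton_one weight_def binom_transform_def)
    next
      case (Cons j js')
      then have "merged_term (1 # M js) = (\<lambda>k. double_sum (merged_term (M js)) k / real k)"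
        by (simp add: fun_eq_iff merged_term_Cons M_def weight_def)
      then show ?thesis
        using mhs_star_one_transform[OF that, of n] Cons by simp
    qed
    then have "mhs_star n (replicate m 2 @ [1] @ S js)
        = binom_transform n (\<lambda>k. merged_term (1 # M js) k / real k ^ (2 * m))"
      using mhs_star_twos_transform[of "1 # S js"] by simp
    also have "\<dots> = binom_transform n (merged_term ((2 * int m + 1) # M js))"
    proof (rule binom_transform_cong)
      fix k :: nat
      have "weight (2 * int m + 1) k = 1 / real k ^ (2 * m) * weight 1 k"
        by (simp add: weight_odd)
      from merged_term_reweight[OF this, of "M js"]
      show "merged_term (1 # M js) k / real k ^ (2 * m) = merged_term ((2 * int m + 1) # M js) k"
        by simp
    qed
    finally show ?thesis .
  qed
  have blocks: "js \<noteq> [] \<Longrightarrow> \<forall>j\<in>set js. c j \<ge> 3 \<Longrightarrow>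
      mhs_star n (S js) = binom_transform n (merged_term (M js))" for n js
  proof (induction js arbitrary: n)
    case (Cons j js)
    let ?s = "replicate (a j) 2 @ [1] @ S js"
    let ?ts = "- (2 * int (a j) + 2) # M js"
    let ?t = "replicate (nat (c j - 3)) 1 @ ?ts"
    have "mhs_star n (c j # ?s) = binom_transform n (merged_term (- 2 # ?t))" for n
    proof (rule mhs_star_ge3_transform)
      show "mhs_star n ?s = binom_transform n (merged_term ((2 * int (a j) + 1) # M js))" for n
        by (rule prefix_one) (use Cons in auto)
      \<comment> \<open>The odd entry produced by {2}^a, 1 becomes the barred entry 2a+2: their
        weights differ by exactly the factor k (-1)^k.\<close>
      show "merged_term ((2 * int (a j) + 1) # M js) k = real k * ((-1) ^ k * merged_term ?ts k)"
        if "k \<ge> 1" for k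
      proof -
        have "weight (2 * int (a j) + 1) k
            = (real k * (-1) ^ k) * weight (- (2 * int (a j) + 2)) k"
          using that unfolding weight_odd weight_neg_even
          by (simp add: weight_def power_add power2_eq_square power_mult_distrib[symmetric] field_simps)
        from merged_term_reweight[OF this, of "M js"] show ?thesis by (simp only: mult.assoc)
      qed
    qed (use Cons in auto)
    then have "mhs_star n (replicate (b j) 2 @ c j # ?s)
        = binom_transform n (\<lambda>k. merged_term (- 2 # ?t) k / real k ^ (2 * b j))"
      by (rule mhs_star_twos_transform)
    \<comment> \<open>The leading twos enlarge the barred 2 created by \<open>c j\<close> to the
      barred 2b+2.\<close>
    also have "\<dots> = binom_transform n (merged_term (- (2 * int (b j) + 2) # ?t))"
    proof (rule binom_transform_cong)
      fix k :: nat
      have "weight (- (2 * int (b j) + 2)) k = 1 / real k ^ (2 * b j) * weight (- 2) k"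
        unfolding weight_neg_even by (simp add: weight_def power_add power2_eq_square)
      from merged_term_reweight[OF this, of ?t]
      show "merged_term (- 2 # ?t) k / real k ^ (2 * b j)
          = merged_term (- (2 * int (b j) + 2) # ?t) k" by simp
    qed
    finally show ?case by (simp add: S_def M_def)
  qed simp
  show "js \<noteq> [] \<Longrightarrow> mhs_star n (S js) = binom_transform n (merged_term (M js))"
    using blocks assms(3) by blast
  show "mhs_star n (replicate m 2 @ [1] @ S js)
      = binom_transform n (merged_term ((2 * int m + 1) # M js))"
    using prefix_one blocks assms(3) by blast
qed

theorem theorem5p1:
  fixes a b :: "nat \<Rightarrow> nat" and c :: "nat \<Rightarrow> int" and r n :: nat
  assumes "n \<ge> 1" and "\<forall>j\<in>{1..r}. c j \<ge> 3"
  shows "(r \<ge> 1 \<longrightarrow>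
            mhs_star n (star_blocks a b c r) =
              (\<Sum>p\<in>merges (merge_blocks a b c r). 2 ^ length p * binom_mhs n p)) \<and>
         mhs_star n (replicate (a 0) 2 @ [1] @ star_blocks a b c r) =
           (\<Sum>p\<in>merges ((2 * int (a 0) + 1) # merge_blocks a b c r). 2 ^ length p * binom_mhs n p)"
proof -
  have c: "\<forall>j\<in>set [1..<r + 1]. c j \<ge> 3" using assms(2) by auto
  have nz: "0 \<notin> set (merge_blocks a b c r)"
    by (auto simp: merge_blocks_def)
  \<comment> \<open>For r = 0 the first identity would compare the empty star sum 1 with the
    conventional value 0.\<close>
  have "r \<ge> 1 \<Longrightarrow> merge_blocks a b c r \<noteq> []"
    by (auto simp: merge_blocks_def)
  then show ?thesis
    using mhs_star_blocks_transform[OF c, where a = a and b = b and n = n] nz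
    by (auto simp: sum_merges_binom_mhs star_blocks_def merge_blocks_def)
qed

end
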